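(* Every finite nilpotent group is an RCC-group; that is, for every finite nilpotent group $G$ and every automorphism $\alpha$ of $G$, the permutation $\alpha$ of $G$ has a cycle whose length equals $\mathrm{ord}(\alpha)$.
   Context: For a permutation $\sigma$ of a finite set $X$, a regular cycle of $\sigma$ is a cycle whose length equals the order of $\sigma$ (cycles of length $1$, i.e. fixed points, are counted as cycles). $\sigma$ satisfies the regular cycle condition (RCC) if it has a regular cycle. A finite group is an RCC-group if every automorphism of it, viewed as a permutation of its underlying set, satisfies the RCC. *)

theory Defs
  imports
    "HOL-Algebra.Bij"
    "HOL-Algebra.Generated_Groups"
    "HOL-Algebra.Multiplicative_Group"
    "HOL-Combinatorics.Orbits"
begin

text \<open>
  A permutation of \<open>X\<close> is an element of \<open>Bij X\<close>, and its order is its order in the group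
  \<open>BijGroup X\<close>. A cycle is represented by the set of points that it moves around (an orbit), so its
  length is the cardinality of that set; the orbit \<open>{x}\<close> of a fixed point \<open>x\<close> is a cycle of length 1.
\<close>

definition regular_cycle :: "'a set \<Rightarrow> ('a \<Rightarrow> 'a) \<Rightarrow> 'a set \<Rightarrow> bool" where
  "regular_cycle X \<sigma> C \<longleftrightarrow> C \<subseteq> X \<and> cyclic_on \<sigma> C \<and> card C = group.ord (BijGroup X) \<sigma>"

definition RCC :: "'a set \<Rightarrow> ('a \<Rightarrow> 'a) \<Rightarrow> bool" where
  "RCC X \<sigma> \<longleftrightarrow> (\<exists>C. regular_cycle X \<sigma> C)"

definition RCC_group :: "('a, 'b) monoid_scheme \<Rightarrow> bool" where
  "RCC_group G \<longleftrightarrow> group G \<and> finite (carrier G) \<and> (\<forall>\<alpha> \<in> auto G. RCC (carrier G) \<alpha>)"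

text \<open>The index is shifted by one: \<open>lower_central_series G n\<close> is usually written \<open>\<gamma>\<^sub>n\<^sub>+\<^sub>1(G)\<close>.\<close>

primrec lower_central_series :: "('a, 'b) monoid_scheme \<Rightarrow> nat \<Rightarrow> 'a set" where
  "lower_central_series G 0 = carrier G"
| "lower_central_series G (Suc n) =
     generate G (\<Union>x \<in> lower_central_series G n. \<Union>y \<in> carrier G.
       {x \<otimes>\<^bsub>G\<^esub> y \<otimes>\<^bsub>G\<^esub> inv\<^bsub>G\<^esub> x \<otimes>\<^bsub>G\<^esub> inv\<^bsub>G\<^esub> y})"

definition nilpotent_group :: "('a, 'b) monoid_scheme \<Rightarrow> bool" where
  "nilpotent_group G \<longleftrightarrow> group G \<and> (\<exists>n. lower_central_series G n = {\<one>\<^bsub>G\<^esub>})"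

end

theory Submission
  imports Defs "HOL-Algebra.Sylow"
begin

text \<open>
  Let \<open>\<alpha>\<close> have order \<open>n\<close> and put \<open>\<beta>\<^sub>q = \<alpha>\<^sup>n\<^sup>/\<^sup>q\<close> for the primes \<open>q\<close> dividing \<open>n\<close>. A point lies on a regular cycle
  as soon as every \<open>\<beta>\<^sub>q\<close> moves it, so the task is to find a point outside all the proper subgroups
  \<open>Fix(\<beta>\<^sub>q)\<close>. Each \<open>\<beta>\<^sub>q\<close> moves a point of some Sylow subgroup, and the Sylow subgroups for different
  primes commute elementwise, so it is enough to treat a \<open>p\<close>-group and multiply the points found.

  In a \<open>p\<close>-group \<open>P\<close> with derived subgroup \<open>D\<close>, no proper subgroup supplements \<open>D\<close>. Hence
  \<open>W = Fix(\<beta>\<^sub>p) D / D\<close> is proper in \<open>V = P/D\<close>; for \<open>q \<noteq> p\<close> every \<open>\<beta>\<^sub>q\<close>-invariant coset of \<open>D\<close> contains a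
  fixed point, so \<open>\<beta>\<^sub>q\<close> acts nontrivially on \<open>V\<close>. Start with \<open>v \<in> V\<close> outside \<open>W\<close> and deal with the primes
  \<open>q \<noteq> p\<close> one at a time: if \<open>\<beta>\<^sub>q\<close> fixes \<open>v\<close>, replace \<open>v\<close> by \<open>v u\<close> with \<open>u = w\<^sup>-\<^sup>1\<beta>\<^sub>q(w) \<noteq> 1\<close>. The norm of \<open>v u\<close> under
  \<open>\<beta>\<^sub>q\<close> is \<open>v\<^sup>q\<close>, so \<open>v u\<close> lies in no \<open>\<beta>\<^sub>q\<close>-invariant subgroup that \<open>v\<close> avoids, and \<open>\<beta>\<^sub>q\<close> moves it.
\<close>

subsection \<open>Orbits\<close>

text \<open>The orbit has as many elements as the first positive return time \<open>d\<close> of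
  \<open>x\<close>. Exponents may be reduced modulo \<open>d\<close>, and below \<open>d\<close>
  only the exponent 0 returns to \<open>x\<close>.\<close>

lemma card_orbit_dvd_iff:
  assumes "x \<in> orbit f x"
  shows "card (orbit f x) dvd n \<longleftrightarrow> (f ^^ n) x = x"
proof -
  define d where "d = funpow_dist1 f x x"
  have card: "card (orbit f x) = d"
    using orbit_conv_funpow_dist1[OF assms] inj_on_funpow_dist1[OF assms]
    by (simp add: d_def card_image)
  have d: "(f ^^ d) x = x" "d > 0"
    using funpow_dist1_prop[OF assms] by (auto simp: d_def)
  have "(f ^^ (n mod d)) x = (f ^^ n) x"
    using d(1) by (rule funpow_mod_eq)
  moreover have "(f ^^ (n mod d)) x = x \<longleftrightarrow> n mod d = 0"
    using funpow_dist1_least[of "n mod d" f x x] d(2) by (fastforce simp: d_def)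
  ultimately show ?thesis
    by (auto simp: card dvd_eq_mod_eq_0)
qed

lemma self_in_orbitI:
  assumes "(f ^^ n) x = x" "n > 0"
  shows "x \<in> orbit f x"
  unfolding orbit_altdef using assms by force

text \<open>Orbits have length 1 or \<open>q\<close>; without a fixed point, \<open>X\<close> would
  be a disjoint union of orbits of length \<open>q\<close>. The intended sets \<open>X\<close> are
  cosets.\<close>

lemma fixed_point_of_prime_period:
  assumes "finite X" "f \<in> X \<rightarrow> X" "\<And>x. x \<in> X \<Longrightarrow> (f ^^ q) x = x" "prime q" "\<not> q dvd card X"
  shows "\<exists>x\<in>X. f x = x"
proof (rule ccontr)
  assume nofix: "\<not> (\<exists>x\<in>X. f x = x)"
  have self: "x \<in> orbit f x" if "x \<in> X" for x
    using assms(3)[OF that] prime_gt_0_nat[OF assms(4)] by (rule self_in_orbitI)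
  have sub: "orbit f x \<subseteq> X" if "x \<in> X" for x
  proof
    fix y assume "y \<in> orbit f x"
    then show "y \<in> X" using that assms(2) by induction auto
  qed
  have card: "card (orbit f x) = q" if x: "x \<in> X" for x
  proof -
    have "card (orbit f x) dvd q"
      using card_orbit_dvd_iff[OF self[OF x]] assms(3)[OF x] by blast
    moreover have "card (orbit f x) \<noteq> 1"
      using card_orbit_dvd_iff[OF self[OF x], of 1] nofix x by auto
    ultimately show ?thesis
      using assms(4) by (auto simp: prime_nat_iff)
  qed
  have X: "\<Union>(orbit f ` X) = X"
    using self sub by blast
  have "q dvd card (\<Union>(orbit f ` X))"
  proof (rule dvd_partition)
    show "\<forall>c\<in>orbit f ` X. q dvd card c"
      using card by auto
    show "\<forall>c1\<in>orbit f ` X. \<forall>c2\<in>orbit f ` X. c1 \<noteq> c2 \<longrightarrow> c1 \<inter> c2 = {}"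
    proof (intro ballI impI)
      fix c1 c2 assume "c1 \<in> orbit f ` X" "c2 \<in> orbit f ` X" and ne: "c1 \<noteq> c2"
      then have c: "cyclic_on f c1" "cyclic_on f c2"
        using self by (auto simp: cyclic_on_def)
      show "c1 \<inter> c2 = {}"
        using orbit_cyclic_eq3[OF c(1)] orbit_cyclic_eq3[OF c(2)] ne by blast
    qed
  qed (use assms(1) in \<open>simp add: X\<close>)
  then show False using assms(5) X by simp
qed

subsection \<open>Finite nilpotent groups\<close>

context group
begin

section \<open>Lower central series and the normalizer condition\<close>

lemma subgroup_lower_central_series: "subgroup (lower_central_series G n) G"
proof (induction n)
  case 0
  then show ?case by (simp add: subgroup_self)
next
  case (Suc n)
  then show ?case
    unfolding lower_central_series.simps
    by (intro generate_is_subgroup) (auto dest: subgroup.mem_carrier)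
qed

lemma commutator_in_lower_central_series:
  assumes "x \<in> lower_central_series G n" "y \<in> carrier G"
  shows "x \<otimes> y \<otimes> inv x \<otimes> inv y \<in> lower_central_series G (Suc n)"
  using assms by (auto intro!: generate.incl)

lemma lower_central_series_subgroup_mono:
  assumes H: "subgroup H G"
  shows "lower_central_series (G\<lparr>carrier := H\<rparr>) n \<subseteq> lower_central_series G n"
proof (induction n)
  case 0
  then show ?case using subgroup.subset[OF H] by simp
next
  case (Suc n)
  interpret H: group "G\<lparr>carrier := H\<rparr>"
    using H by (rule subgroup_imp_group)
  let ?L = "lower_central_series (G\<lparr>carrier := H\<rparr>) n"
  have LH: "?L \<subseteq> H"
    using subgroup.subset[OF H.subgroup_lower_central_series[of n]] by simp
  let ?S = "\<Union>x\<in>?L. \<Union>y\<in>H. {x \<otimes> y \<otimes> inv x \<otimes> inv y}"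
  have S: "?S \<subseteq> H"
    using LH subgroupE(3,4)[OF H] by auto
  have "lower_central_series (G\<lparr>carrier := H\<rparr>) (Suc n) = generate (G\<lparr>carrier := H\<rparr>) ?S"
    using LH by (auto simp: m_inv_consistent[OF H] subset_iff intro!: arg_cong[where f = "generate _"])
  also have "\<dots> = generate G ?S"
    using S H by (rule generate_consistent)
  also have "\<dots> \<subseteq> lower_central_series G (Suc n)"
    unfolding lower_central_series.simps
    using Suc.IH subgroup.subset[OF H] by (intro mono_generate) blast
  finally show ?case .
qed

lemma nilpotent_subgroup:
  assumes "nilpotent_group G" "subgroup H G"
  shows "nilpotent_group (G\<lparr>carrier := H\<rparr>)"
proof -
  interpret H: group "G\<lparr>carrier := H\<rparr>"
    using assms(2) by (rule subgroup_imp_group)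
  obtain n where "lower_central_series G n = {\<one>}"
    using assms(1) by (auto simp: nilpotent_group_def)
  then have "lower_central_series (G\<lparr>carrier := H\<rparr>) n = {\<one>}"
    using lower_central_series_subgroup_mono[OF assms(2), of n]
      subgroup.one_closed[OF H.subgroup_lower_central_series[of n]] by auto
  then show ?thesis
    using H.is_group by (auto simp: nilpotent_group_def)
qed

text \<open>The lower central series starts outside \<open>H\<close> and ends inside it, so some
  term is not contained in \<open>H\<close> while the next one is. Commutators of that term with
  elements of \<open>H\<close> lie in \<open>H\<close>, so the term normalizes
  \<open>H\<close>.\<close>

lemma nilpotent_normalizer_condition:
  assumes "nilpotent_group G" "subgroup H G" "H \<noteq> carrier G"
  shows "\<exists>x\<in>carrier G - H. \<forall>h\<in>H. x \<otimes> h \<otimes> inv x \<in> H \<and> inv x \<otimes> h \<otimes> x \<in> H"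
proof -
  obtain n where n: "lower_central_series G n = {\<one>}"
    using assms(1) by (auto simp: nilpotent_group_def)
  have "\<exists>i. lower_central_series G (Suc i) \<subseteq> H \<and> \<not> lower_central_series G i \<subseteq> H"
  proof (rule ccontr)
    assume *: "\<not> ?thesis"
    have "\<not> lower_central_series G i \<subseteq> H" for i
    proof (induction i)
      case 0
      then show ?case using assms(3) subgroup.subset[OF assms(2)] by auto
    qed (use * in blast)
    then have "\<not> lower_central_series G n \<subseteq> H" .
    then show False using n subgroup.one_closed[OF assms(2)] by simp
  qed
  then obtain i x where i: "lower_central_series G (Suc i) \<subseteq> H"
    and x: "x \<in> lower_central_series G i" "x \<notin> H" by blast
  have conj: "y \<otimes> h \<otimes> inv y \<in> H" if y: "y \<in> lower_central_series G i" and h: "h \<in> H" for y h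
  proof -
    have c: "y \<in> carrier G" "h \<in> carrier G"
      using subgroup.mem_carrier[OF subgroup_lower_central_series y] subgroup.mem_carrier[OF assms(2) h] .
    have "y \<otimes> h \<otimes> inv y \<otimes> inv h \<in> H"
      using commutator_in_lower_central_series[OF y c(2)] i by blast
    then have "y \<otimes> h \<otimes> inv y \<otimes> inv h \<otimes> h \<in> H"
      using h assms(2) subgroup.m_closed by metis
    then show ?thesis using c by (simp add: m_assoc)
  qed
  have "x \<in> carrier G" "inv x \<in> lower_central_series G i"
    using x(1) subgroup_lower_central_series subgroup.mem_carrier subgroup.m_inv_closed by metis+
  then show ?thesis
    using conj[OF x(1)] conj[of "inv x"] x(2) by (intro bexI[of _ x]) auto
qed

text \<open>The normalizer of \<open>H\<close>. Asking for conjugation by both \<open>g\<close> and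
  \<open>inv g\<close> makes closure under inverses immediate.\<close>

definition conj_stabilizer :: "'a set \<Rightarrow> 'a set" where
  "conj_stabilizer H = {g \<in> carrier G. \<forall>h\<in>H. g \<otimes> h \<otimes> inv g \<in> H \<and> inv g \<otimes> h \<otimes> g \<in> H}"

lemma conj_stabilizer_subgroup:
  assumes "H \<subseteq> carrier G"
  shows "subgroup (conj_stabilizer H) G"
proof (rule subgroupI)
  show "conj_stabilizer H \<noteq> {}"
    using assms by (auto simp: conj_stabilizer_def subset_iff intro!: exI[of _ \<one>])
next
  fix a b assume ab: "a \<in> conj_stabilizer H" "b \<in> conj_stabilizer H"
  then have c: "a \<in> carrier G" "b \<in> carrier G" by (auto simp: conj_stabilizer_def)
  have "(a \<otimes> b) \<otimes> h \<otimes> inv (a \<otimes> b) = a \<otimes> (b \<otimes> h \<otimes> inv b) \<otimes> inv a"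
    "inv (a \<otimes> b) \<otimes> h \<otimes> (a \<otimes> b) = inv b \<otimes> (inv a \<otimes> h \<otimes> a) \<otimes> b" if "h \<in> H" for h
    using c that assms by (auto simp: m_assoc inv_mult_group subset_iff)
  then show "a \<otimes> b \<in> conj_stabilizer H"
    using ab by (simp add: conj_stabilizer_def)
qed (auto simp: conj_stabilizer_def)

lemma subset_conj_stabilizer:
  assumes "subgroup H G"
  shows "H \<subseteq> conj_stabilizer H"
  using subgroupE(1,3,4)[OF assms] by (auto simp: conj_stabilizer_def)

lemma subgroup_normal_in_conj_stabilizer:
  assumes "subgroup H G"
  shows "H \<lhd> G\<lparr>carrier := conj_stabilizer H\<rparr>"
proof -
  have N: "subgroup (conj_stabilizer H) G"
    using subgroupE(1)[OF assms] by (rule conj_stabilizer_subgroup)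
  interpret N: group "G\<lparr>carrier := conj_stabilizer H\<rparr>"
    using N by (rule subgroup_imp_group)
  have "subgroup H (G\<lparr>carrier := conj_stabilizer H\<rparr>)"
    using subgroup_incl[OF assms N subset_conj_stabilizer[OF assms]] .
  then show ?thesis
  proof (rule N.normal_invI)
    fix x h assume "x \<in> carrier (G\<lparr>carrier := conj_stabilizer H\<rparr>)" "h \<in> H"
    then show "x \<otimes>\<^bsub>G\<lparr>carrier := conj_stabilizer H\<rparr>\<^esub> h \<otimes>\<^bsub>G\<lparr>carrier := conj_stabilizer H\<rparr>\<^esub>
        inv\<^bsub>G\<lparr>carrier := conj_stabilizer H\<rparr>\<^esub> x \<in> H"
      using m_inv_consistent[OF N, of x] by (auto simp: conj_stabilizer_def)
  qed
qed

section \<open>Maximal subgroups and the derived subgroup\<close>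

lemma inv_commute:
  assumes "a \<otimes> g = g \<otimes> a" "a \<in> carrier G" "g \<in> carrier G"
  shows "inv a \<otimes> g = g \<otimes> inv a"
  using assms by (metis inv_closed inv_solve_left inv_solve_right m_assoc m_closed)

lemma mult_commute:
  assumes "a \<otimes> g = g \<otimes> a" "b \<otimes> g = g \<otimes> b" "a \<in> carrier G" "b \<in> carrier G" "g \<in> carrier G"
  shows "a \<otimes> b \<otimes> g = g \<otimes> (a \<otimes> b)"
  using assms by (metis m_assoc)

text \<open>The second hypothesis says that the quotient by \<open>M\<close> is commutative. It
  gives \<open>x \<otimes> y = m \<otimes> (y \<otimes> x)\<close> with \<open>m\<close> in
  \<open>M\<close>, and this \<open>m\<close> is the commutator.\<close>

lemma derived_le_of_comm_FactGroup:
  assumes "M \<lhd> G" "\<And>x y. x \<in> carrier G \<Longrightarrow> y \<in> carrier G \<Longrightarrow> M #> (x \<otimes> y) = M #> (y \<otimes> x)"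
  shows "derived G (carrier G) \<subseteq> M"
  unfolding derived_def
proof (rule generate_subgroup_incl)
  interpret M: normal M G by fact
  show "subgroup M G" by (rule M.subgroup_axioms)
  show "derived_set G (carrier G) \<subseteq> M"
  proof clarify
    fix x y assume c: "x \<in> carrier G" "y \<in> carrier G"
    have "x \<otimes> y \<in> M #> (y \<otimes> x)"
      using assms(2)[OF c] rcos_self[of "x \<otimes> y" M] c M.subgroup_axioms by simp
    then obtain m where m: "m \<in> M" "x \<otimes> y = m \<otimes> (y \<otimes> x)"
      by (auto simp: r_coset_def)
    have "m = x \<otimes> y \<otimes> inv (y \<otimes> x)"
      using m c M.mem_carrier[OF m(1)] by (metis inv_solve_right m_closed)
    also have "\<dots> = x \<otimes> y \<otimes> inv x \<otimes> inv y"
      using c by (simp add: inv_mult_group m_assoc)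
    finally show "x \<otimes> y \<otimes> inv x \<otimes> inv y \<in> M"
      using m(1) by simp
  qed
qed

text \<open>The normalizer condition and maximality make \<open>M\<close> normal. Maximality then
  also shows that every element of the quotient is central, so the quotient is commutative.\<close>

lemma nilpotent_maximal_subgroup:
  assumes "nilpotent_group G" "subgroup M G" "M \<noteq> carrier G"
    and max: "\<And>K. subgroup K G \<Longrightarrow> M \<subset> K \<Longrightarrow> K = carrier G"
  shows "derived G (carrier G) \<subseteq> M"
proof -
  have "conj_stabilizer M = carrier G"
  proof (rule max)
    obtain x where "x \<in> conj_stabilizer M" "x \<notin> M"
      using nilpotent_normalizer_condition[OF assms(1-3)] by (auto simp: conj_stabilizer_def)
    then show "M \<subset> conj_stabilizer M"
      using subset_conj_stabilizer[OF assms(2)] by blast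
  qed (rule conj_stabilizer_subgroup[OF subgroupE(1)[OF assms(2)]])
  then have norm: "M \<lhd> G"
    using subgroup_normal_in_conj_stabilizer[OF assms(2)] by simp
  then interpret M: normal M G .
  interpret Q: group "G Mod M" by (rule M.factorgroup_is_group)
  have mult: "M #> (x \<otimes> y) = (M #> x) \<otimes>\<^bsub>G Mod M\<^esub> (M #> y)"
    if "x \<in> carrier G" "y \<in> carrier G" for x y
    using that by (simp add: M.rcos_sum)
  have Qc: "M #> x \<in> carrier (G Mod M)" if "x \<in> carrier G" for x
    using that by (auto simp: carrier_FactGroup)
  show ?thesis
  proof (rule derived_le_of_comm_FactGroup[OF norm])
    fix x g assume x: "x \<in> carrier G" and g: "g \<in> carrier G"
    show "M #> (x \<otimes> g) = M #> (g \<otimes> x)"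
    proof (cases "g \<in> M")
      case True
      then have "M #> g = \<one>\<^bsub>G Mod M\<^esub>"
        using M.rcos_const by simp
      then show ?thesis
        using mult[OF x g] mult[OF g x] Qc[OF x] by (simp del: mult_FactGroup one_FactGroup)
    next
      case False
      \<comment> \<open>The preimage of the centralizer of the coset of \<open>g\<close>. It
        contains \<open>M\<close> and also \<open>g\<close>, which is outside \<open>M\<close>, so
        maximality makes it the whole group.\<close>
      define C where "C = {x \<in> carrier G. M #> (x \<otimes> g) = M #> (g \<otimes> x)}"
      have C_alt: "C = {x \<in> carrier G. (M #> x) \<otimes>\<^bsub>G Mod M\<^esub> (M #> g) = (M #> g) \<otimes>\<^bsub>G Mod M\<^esub> (M #> x)}"
        using g by (auto simp: C_def mult simp del: mult_FactGroup)
      have "subgroup C G"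
      proof (rule subgroupI)
        show "C \<noteq> {}" using g by (auto simp: C_def)
      next
        fix a assume "a \<in> C"
        then have a: "a \<in> carrier G" "(M #> a) \<otimes>\<^bsub>G Mod M\<^esub> (M #> g) = (M #> g) \<otimes>\<^bsub>G Mod M\<^esub> (M #> a)"
          by (auto simp: C_alt)
        have "M #> inv a = inv\<^bsub>G Mod M\<^esub> (M #> a)"
          using a(1) by (metis M.inv_FactGroup M.rcos_inv Qc)
        moreover have "inv\<^bsub>G Mod M\<^esub> (M #> a) \<otimes>\<^bsub>G Mod M\<^esub> (M #> g) =
            (M #> g) \<otimes>\<^bsub>G Mod M\<^esub> inv\<^bsub>G Mod M\<^esub> (M #> a)"
          using a(2) Qc[OF a(1)] Qc[OF g] by (rule Q.inv_commute)
        ultimately show "inv a \<in> C"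
          using a(1) by (simp add: C_alt del: mult_FactGroup)
      next
        fix a b assume ab: "a \<in> C" "b \<in> C"
        then have c: "a \<in> carrier G" "b \<in> carrier G" by (auto simp: C_def)
        have "(M #> a) \<otimes>\<^bsub>G Mod M\<^esub> (M #> b) \<otimes>\<^bsub>G Mod M\<^esub> (M #> g) =
            (M #> g) \<otimes>\<^bsub>G Mod M\<^esub> ((M #> a) \<otimes>\<^bsub>G Mod M\<^esub> (M #> b))"
          using ab Qc[OF c(1)] Qc[OF c(2)] Qc[OF g] by (intro Q.mult_commute) (simp_all only: C_alt mem_Collect_eq)
        then show "a \<otimes> b \<in> C"
          using c by (simp add: C_alt mult del: mult_FactGroup)
      qed (auto simp: C_def)
      moreover have "M \<subseteq> C"
      proof
        fix a assume a: "a \<in> M"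
        then have "M #> a = \<one>\<^bsub>G Mod M\<^esub>"
          using M.rcos_const by simp
        then show "a \<in> C"
          using M.mem_carrier[OF a] Qc[OF g] by (simp add: C_alt del: mult_FactGroup one_FactGroup)
      qed
      moreover have "g \<in> C" using g by (simp add: C_def)
      ultimately have "C = carrier G" using False by (intro max) auto
      then show ?thesis using x by (auto simp: C_def)
    qed
  qed
qed

text \<open>By finiteness \<open>H\<close> lies in a maximal subgroup. That subgroup contains the
  derived subgroup too, and hence the product.\<close>

lemma nilpotent_proper_subgroup_derived:
  assumes "nilpotent_group G" "finite (carrier G)" "subgroup H G" "H \<noteq> carrier G"
  shows "H <#> derived G (carrier G) \<noteq> carrier G"
proof -
  let ?S = "{M. subgroup M G \<and> M \<noteq> carrier G \<and> H \<subseteq> M}"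
  have "?S \<subseteq> Pow (carrier G)" by (auto dest: subgroup.mem_carrier)
  then have "finite ?S" using assms(2) by (simp add: finite_subset)
  moreover have "H \<in> ?S" using assms(3,4) by simp
  ultimately obtain M where "M \<in> ?S" and max: "\<And>K. K \<in> ?S \<Longrightarrow> M \<subseteq> K \<Longrightarrow> M = K"
    using finite_has_maximal[of ?S] by auto
  then have M: "subgroup M G" "M \<noteq> carrier G" "H \<subseteq> M" by auto
  have "derived G (carrier G) \<subseteq> M"
  proof (rule nilpotent_maximal_subgroup[OF assms(1) M(1,2)])
    fix K assume "subgroup K G" "M \<subset> K"
    then show "K = carrier G" using max[of K] M(3) by blast
  qed
  then have "H <#> derived G (carrier G) \<subseteq> M"
    using M(3) subgroup.m_closed[OF M(1)] by (auto simp: set_mult_def)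
  then show ?thesis
    using M(2) subgroup.subset[OF M(1)] by blast
qed

section \<open>Sylow subgroups of a finite nilpotent group\<close>

text \<open>For prime \<open>p\<close> and a finite nilpotent group this turns out to be the Sylow
  \<open>p\<close>-subgroup. Described by a power condition, it is visibly preserved by every
  endomorphism.\<close>

definition prime_part :: "nat \<Rightarrow> 'a set" where
  "prime_part p = {x \<in> carrier G. x [^] (p ^ multiplicity p (order G)) = \<one>}"

text \<open>\<open>P\<close> uses up the full power of \<open>p\<close> in \<open>order G\<close>,
  so its normalizer modulo \<open>P\<close> has order prime to \<open>p\<close>. The coset of
  \<open>x\<close> there has \<open>p\<close>-power order, hence is trivial.\<close>

lemma sylow_mem_of_conj_stabilizer:
  assumes fin: "finite (carrier G)" and p: "prime p" and P: "subgroup P G"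
    and card: "card P = p ^ multiplicity p (order G)"
    and x: "x \<in> conj_stabilizer P" "x [^] (p ^ k) = \<one>"
  shows "x \<in> P"
proof -
  let ?N = "G\<lparr>carrier := conj_stabilizer P\<rparr>"
  have N: "subgroup (conj_stabilizer P) G"
    using subgroupE(1)[OF P] by (rule conj_stabilizer_subgroup)
  interpret N: group ?N using N by (rule subgroup_imp_group)
  interpret P: normal P ?N using subgroup_normal_in_conj_stabilizer[OF P] .
  let ?Q = "?N Mod P"
  interpret Q: group ?Q by (rule P.factorgroup_is_group)
  have order_pos: "order G \<noteq> 0"
    using fin order_gt_0_iff_finite by simp
  have "order ?Q * card P = order ?N"
    using N.lagrange[OF P.subgroup_axioms] by (simp add: order_def FactGroup_def)
  moreover have "order ?N dvd order G"
    using dvd_triv_right[of "card (conj_stabilizer P)" "card (rcosets (conj_stabilizer P))"] lagrange[OF N]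
    by (simp add: order_def)
  ultimately have dvd: "order ?Q * p ^ multiplicity p (order G) dvd order G"
    using card by simp
  have ndvd: "\<not> p dvd order ?Q"
  proof
    assume "p dvd order ?Q"
    then have "p ^ Suc (multiplicity p (order G)) dvd order G"
      using dvd_trans[OF mult_dvd_mono[OF _ dvd_refl] dvd] by simp
    then have "Suc (multiplicity p (order G)) \<le> multiplicity p (order G)"
      using p order_pos not_prime_unit by (intro multiplicity_geI) auto
    then show False by simp
  qed
  have xQ: "P #>\<^bsub>?N\<^esub> x \<in> carrier ?Q"
    using x(1) unfolding carrier_FactGroup by simp
  have "(P #>\<^bsub>?N\<^esub> x) [^]\<^bsub>?Q\<^esub> (p ^ k) = P #>\<^bsub>?N\<^esub> (x [^]\<^bsub>?N\<^esub> (p ^ k))"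
    using P.FactGroup_pow[of x "p ^ k"] x(1) by simp
  also have "\<dots> = \<one>\<^bsub>?Q\<^esub>"
    using x(2) nat_pow_consistent[of x "p ^ k" "conj_stabilizer P"] P.rcos_const[of \<one>] P.one_closed
    by simp
  finally have "Q.ord (P #>\<^bsub>?N\<^esub> x) dvd p ^ k"
    using Q.pow_eq_id[OF xQ] by blast
  moreover have "Q.ord (P #>\<^bsub>?N\<^esub> x) dvd order ?Q"
    using xQ by (rule Q.ord_dvd_group_order)
  moreover have "coprime (p ^ k) (order ?Q)"
    using ndvd p by (simp add: prime_imp_coprime)
  ultimately have "Q.ord (P #>\<^bsub>?N\<^esub> x) = 1"
    by (metis coprime_common_divisor_nat coprime_def nat_dvd_1_iff_1)
  then have "P #>\<^bsub>?N\<^esub> x = P"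
    using Q.ord_eq_1[OF xQ] by simp
  then show ?thesis
    using N.rcos_self[of x P] x(1) P.subgroup_axioms by simp
qed

text \<open>The normalizer \<open>?N\<close> of a Sylow subgroup \<open>P\<close> is its own
  normalizer: conjugating \<open>P\<close> by an element that normalizes \<open>?N\<close> gives
  elements of \<open>?N\<close> of \<open>p\<close>-power order, which lie in \<open>P\<close>
  again. By the normalizer condition \<open>?N\<close> is the whole group.\<close>

lemma nilpotent_prime_part:
  assumes nil: "nilpotent_group G" and fin: "finite (carrier G)" and p: "prime p"
  shows "prime_part p \<lhd> G" "card (prime_part p) = p ^ multiplicity p (order G)"
proof -
  let ?a = "multiplicity p (order G)"
  have "p ^ ?a dvd order G" by (rule multiplicity_dvd)
  then obtain m where m: "order G = p ^ ?a * m" by blast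
  obtain P where P: "subgroup P G" and card: "card P = p ^ ?a"
    using sylow_thm[OF p is_group m fin] by blast
  let ?N = "conj_stabilizer P"
  have N: "subgroup ?N G"
    using subgroupE(1)[OF P] by (rule conj_stabilizer_subgroup)
  have P_pow: "x [^] (p ^ ?a) = \<one>" if "x \<in> P" for x
  proof -
    interpret P: group "G\<lparr>carrier := P\<rparr>" using P by (rule subgroup_imp_group)
    show ?thesis
      using P.pow_order_eq_1[of x] that card nat_pow_consistent[of x "p ^ ?a" P] by (simp add: order_def)
  qed
  have N_eq: "?N = carrier G"
  proof (rule ccontr)
    assume "?N \<noteq> carrier G"
    then obtain x where x: "x \<in> carrier G" "x \<notin> ?N"
      and conj: "\<And>h. h \<in> ?N \<Longrightarrow> x \<otimes> h \<otimes> inv x \<in> ?N \<and> inv x \<otimes> h \<otimes> x \<in> ?N"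
      using nilpotent_normalizer_condition[OF nil N] by blast
    have pow_conj: "(y \<otimes> h \<otimes> inv y) [^] n = y \<otimes> h [^] n \<otimes> inv y"
      if "y \<in> carrier G" "h \<in> carrier G" for y h and n :: nat
      using that by (induction n) (auto simp: m_assoc inv_solve_left')
    have "x \<otimes> h \<otimes> inv x \<in> P \<and> inv x \<otimes> h \<otimes> x \<in> P" if h: "h \<in> P" for h
    proof -
      have hc: "h \<in> carrier G" using subgroup.mem_carrier[OF P h] .
      have "h \<in> ?N" using h subset_conj_stabilizer[OF P] by blast
      note hN = conj[OF this]
      have 1: "(x \<otimes> h \<otimes> inv x) [^] (p ^ ?a) = \<one>"
        using pow_conj[OF x(1) hc] P_pow[OF h] x(1) by simp
      have 2: "(inv x \<otimes> h \<otimes> x) [^] (p ^ ?a) = \<one>"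
        using pow_conj[of "inv x" h "p ^ ?a"] hc P_pow[OF h] x(1) by simp
      show ?thesis
        using sylow_mem_of_conj_stabilizer[OF fin p P card _ 1] sylow_mem_of_conj_stabilizer[OF fin p P card _ 2] hN
        by blast
    qed
    then show False using x by (auto simp: conj_stabilizer_def)
  qed
  have "prime_part p = P"
    using P_pow sylow_mem_of_conj_stabilizer[OF fin p P card] subgroup.mem_carrier[OF P]
    by (auto simp: prime_part_def N_eq)
  then show "prime_part p \<lhd> G" "card (prime_part p) = p ^ ?a"
    using card subgroup_normal_in_conj_stabilizer[OF P] N_eq by auto
qed

lemma hom_image_prime_part:
  assumes "h \<in> hom G G"
  shows "h ` prime_part p \<subseteq> prime_part p"
proof -
  interpret h: group_hom G G h using assms by unfold_locales
  have "h x [^] n = \<one>" if "x \<in> carrier G" "x [^] n = \<one>" for x and n :: nat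
    using h.hom_nat_pow[OF that(1), of n] that(2) by simp
  then show ?thesis
    by (auto simp: prime_part_def)
qed

text \<open>The commutator of \<open>x\<close> and \<open>y\<close> lies in both normal subgroups,
  so its order divides powers of two different primes.\<close>

lemma prime_part_commute:
  assumes nil: "nilpotent_group G" and fin: "finite (carrier G)" and p: "prime p" "prime r" "p \<noteq> r"
    and x: "x \<in> prime_part p" and y: "y \<in> prime_part r"
  shows "x \<otimes> y = y \<otimes> x"
proof -
  have norm: "prime_part p \<lhd> G" "prime_part r \<lhd> G"
    using nilpotent_prime_part(1)[OF nil fin] p by auto
  note sub = norm[THEN normal_imp_subgroup]
  have c: "x \<in> carrier G" "y \<in> carrier G" using x y by (auto simp: prime_part_def)
  let ?c = "x \<otimes> y \<otimes> inv x \<otimes> inv y"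
  have "?c \<in> prime_part r"
    using normal.inv_op_closed2[OF norm(2) c(1) y] subgroup.m_inv_closed[OF sub(2) y]
    by (rule subgroup.m_closed[OF sub(2)])
  moreover have "x \<otimes> (y \<otimes> inv x \<otimes> inv y) \<in> prime_part p"
    using x normal.inv_op_closed2[OF norm(1) c(2) subgroup.m_inv_closed[OF sub(1) x]]
    by (rule subgroup.m_closed[OF sub(1)])
  then have "?c \<in> prime_part p"
    using c by (simp add: m_assoc)
  ultimately have "?c \<in> carrier G" "ord ?c dvd p ^ multiplicity p (order G)" "ord ?c dvd r ^ multiplicity r (order G)"
    by (auto simp: prime_part_def pow_eq_id)
  moreover have "coprime (p ^ multiplicity p (order G)) (r ^ multiplicity r (order G))"
    using p by (simp add: primes_coprime)
  ultimately have "ord ?c = 1"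
    by (metis coprime_common_divisor_nat)
  then have "x \<otimes> y \<otimes> inv (y \<otimes> x) = \<one>"
    using \<open>?c \<in> carrier G\<close> ord_eq_1[of ?c] c by (simp add: inv_mult_group m_assoc)
  then show ?thesis
    using c inv_solve_right'[of "\<one>" "x \<otimes> y" "y \<otimes> x"] by simp
qed

end

subsection \<open>Commuting automorphisms of prime period\<close>

text \<open>Bezout gives \<open>q * s = m * t + 1\<close>, so \<open>x\<close> equals
  \<open>x [^] (q * s)\<close>, a power of \<open>x [^] q\<close>.\<close>

lemma (in group) mem_of_coprime_pow_mem:
  fixes m q :: nat
  assumes K: "subgroup K G" and x: "x \<in> carrier G" "x [^] m = \<one>" "x [^] q \<in> K"
    and cop: "coprime q m"
  shows "x \<in> K"
proof (cases "q = 0")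
  case True
  \<comment> \<open>Coprimality with 0 forces \<open>m = 1\<close>, so \<open>x\<close> is the
    identity.\<close>
  then show ?thesis
    using cop x subgroup.one_closed[OF K] by simp
next
  case False
  then obtain s t where st: "q * s = m * t + 1"
    using bezout_nat[of q m] cop by (auto simp: coprime_iff_gcd_eq_1)
  have "(x [^] q) [^] n \<in> K" for n :: nat
    using x(3) subgroup.one_closed[OF K] by (induction n) (auto intro: subgroup.m_closed[OF K])
  then have "x [^] (q * s) \<in> K"
    using x(1) by (simp add: nat_pow_pow)
  also have "x [^] (q * s) = (x [^] m) [^] t \<otimes> x"
    using x(1) unfolding st by (simp add: nat_pow_pow)
  finally show ?thesis using x(1,2) by simp
qed

lemma funpow_hom_closed:
  assumes "h \<in> hom G G" "x \<in> carrier G"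
  shows "(h ^^ n) x \<in> carrier G"
  using assms by (induction n) (auto simp: hom_def)

section \<open>Avoiding invariant subgroups in an abelian group\<close>

context comm_group
begin

text \<open>Multiplying the first \<open>q\<close> iterated images of
  \<open>v \<otimes> (inv w \<otimes> \<beta> w)\<close> stays in \<open>K\<close>. The factors from
  \<open>w\<close> telescope to the identity, leaving \<open>v [^] q\<close>, and \<open>q\<close>
  is prime to the group order.\<close>

lemma fixed_factor_mem:
  assumes \<beta>: "\<beta> \<in> hom G G" "(\<beta> ^^ q) w = w" and q: "coprime q (order G)"
    and K: "subgroup K G" "\<beta> ` K \<subseteq> K"
    and v: "v \<in> carrier G" "\<beta> v = v" and w: "w \<in> carrier G"
    and mem: "v \<otimes> (inv w \<otimes> \<beta> w) \<in> K"
  shows "v \<in> K"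
proof -
  interpret \<beta>: group_hom G G \<beta>
    using \<beta>(1) by (unfold_locales) 
  have \<beta>_pow: "(\<beta> ^^ n) x \<in> carrier G" if "x \<in> carrier G" for n x
    using \<beta>(1) that by (rule funpow_hom_closed)
  have \<beta>n: "(\<beta> ^^ n) (v \<otimes> (inv w \<otimes> \<beta> w)) = v \<otimes> (inv ((\<beta> ^^ n) w) \<otimes> (\<beta> ^^ Suc n) w)" for n
    using v w \<beta>_pow[OF w] by (induction n) auto
  have \<beta>n_mem: "(\<beta> ^^ n) (v \<otimes> (inv w \<otimes> \<beta> w)) \<in> K" for n
    using mem K(2) by (induction n) auto
  \<comment> \<open>This element is the product of the first \<open>n\<close> iterated images after
    telescoping.\<close>
  have "v [^] n \<otimes> (inv w \<otimes> (\<beta> ^^ n) w) \<in> K" for n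
  proof (induction n)
    case 0
    then show ?case using w subgroup.one_closed[OF K(1)] by simp
  next
    case (Suc n)
    let ?b = "(\<beta> ^^ n) w"
    have "v [^] n \<otimes> (inv w \<otimes> ?b) \<otimes> (v \<otimes> (inv ?b \<otimes> (\<beta> ^^ Suc n) w)) \<in> K"
      using Suc.IH \<beta>n_mem[of n] unfolding \<beta>n by (rule subgroup.m_closed[OF K(1)])
    also have "v [^] n \<otimes> (inv w \<otimes> ?b) \<otimes> (v \<otimes> (inv ?b \<otimes> (\<beta> ^^ Suc n) w)) =
        v [^] n \<otimes> v \<otimes> (inv w \<otimes> (\<beta> ^^ Suc n) w) \<otimes> (?b \<otimes> inv ?b)"
      using v(1) w \<beta>_pow[OF w, of n] \<beta>_pow[OF w, of "Suc n"] by (simp add: m_ac del: r_inv l_inv funpow.simps)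
    finally show ?case
      using v(1) w \<beta>_pow[OF w, of n] by simp
  qed
  from this[of q] have vq: "v [^] q \<in> K"
    using v(1) w \<beta>(2) by simp
  show ?thesis
    using K(1) v(1) pow_order_eq_1[OF v(1)] vq q by (rule mem_of_coprime_pow_mem)
qed

text \<open>If \<open>\<beta>\<close> fixes \<open>v\<close>, multiply it by a nontrivial
  \<open>u = inv w \<otimes> \<beta> w\<close>. The preceding lemma shows that this cannot lead into
  any member of \<open>\<K>\<close> that \<open>v\<close> avoids.\<close>

lemma ex_moved_outside:
  assumes \<beta>: "\<beta> \<in> hom G G" "\<And>x. x \<in> carrier G \<Longrightarrow> (\<beta> ^^ q) x = x" and q: "coprime q (order G)"
    and moves: "\<exists>w\<in>carrier G. \<beta> w \<noteq> w"
    and K: "\<And>K. K \<in> \<K> \<Longrightarrow> subgroup K G" "\<And>K. K \<in> \<K> \<Longrightarrow> \<beta> ` K \<subseteq> K"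
    and v: "v \<in> carrier G" "v \<notin> \<Union>\<K>"
  shows "\<exists>x\<in>carrier G. x \<notin> \<Union>\<K> \<and> \<beta> x \<noteq> x"
proof (cases "\<beta> v = v")
  case False
  then show ?thesis using v by blast
next
  case fixed: True
  interpret \<beta>: group_hom G G \<beta>
    using \<beta>(1) by unfold_locales
  obtain w where w: "w \<in> carrier G" "\<beta> w \<noteq> w"
    using moves by blast
  have \<beta>w: "\<beta> w \<in> carrier G" using w(1) by simp
  define u where "u = inv w \<otimes> \<beta> w"
  have u: "u \<in> carrier G" using w by (simp add: u_def)
  have "v \<otimes> u \<notin> K" if "K \<in> \<K>" for K
    using fixed_factor_mem[OF \<beta>(1) \<beta>(2)[OF w(1)] q K[OF that] v(1) fixed w(1)] v(2) that
    by (auto simp: u_def)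
  moreover have "\<beta> (v \<otimes> u) \<noteq> v \<otimes> u"
  \<comment> \<open>If \<open>v \<otimes> u\<close> were fixed, so would be \<open>inv u\<close>.
    The preceding lemma with \<open>inv u\<close> as the fixed element and the trivial subgroup as
    \<open>K\<close> then gives \<open>u = \<one>\<close>.\<close>
  proof
    assume "\<beta> (v \<otimes> u) = v \<otimes> u"
    then have "\<beta> u = u"
      using fixed v(1) u by simp
    then have "\<beta> (inv u) = inv u" using u by simp
    moreover have "inv u \<otimes> (inv w \<otimes> \<beta> w) \<in> {\<one>}"
      using u by (simp add: u_def[symmetric])
    moreover have "\<beta> ` {\<one>} \<subseteq> {\<one>}" by simp
    ultimately have "inv u \<in> {\<one>}"
      using fixed_factor_mem[OF \<beta>(1) \<beta>(2)[OF w(1)] q triv_subgroup _ inv_closed[OF u] _ w(1)] by blast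
    then have "u = \<one>" using u by simp
    then show False
      using w \<beta>w inv_solve_left'[OF one_closed w(1) \<beta>w] by (simp add: u_def)
  qed
  ultimately show ?thesis
    using v(1) u by blast
qed

end

text \<open>Models the powers of one automorphism that have prime period. Some
  \<open>\<beta> q\<close> may act trivially, so the notion passes to invariant subgroups and to the
  quotient by the derived subgroup. Surjectivity is derived from the period.\<close>

locale prime_period_autos = group +
  fixes Q :: "nat set" and \<beta> :: "nat \<Rightarrow> 'a \<Rightarrow> 'a"
  assumes finite_Q: "finite Q"
    and prime_Q: "q \<in> Q \<Longrightarrow> prime q"
    and hom: "q \<in> Q \<Longrightarrow> \<beta> q \<in> hom G G"
    and period: "q \<in> Q \<Longrightarrow> x \<in> carrier G \<Longrightarrow> (\<beta> q ^^ q) x = x"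
    and commute: "q \<in> Q \<Longrightarrow> r \<in> Q \<Longrightarrow> x \<in> carrier G \<Longrightarrow> \<beta> q (\<beta> r x) = \<beta> r (\<beta> q x)"
begin

definition fixed_points :: "nat \<Rightarrow> 'a set" where
  "fixed_points q = {x \<in> carrier G. \<beta> q x = x}"

lemma group_hom: "q \<in> Q \<Longrightarrow> group_hom G G (\<beta> q)"
  using hom by unfold_locales

lemma closed: "q \<in> Q \<Longrightarrow> x \<in> carrier G \<Longrightarrow> \<beta> q x \<in> carrier G"
  using hom by (auto simp: hom_def)

lemma fixed_points_subgroup:
  assumes "q \<in> Q"
  shows "subgroup (fixed_points q) G"
proof -
  interpret \<beta>: group_hom G G "\<beta> q" using assms by (rule group_hom)
  show ?thesis by (rule subgroupI) (auto simp: fixed_points_def)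
qed

lemma fixed_points_invariant:
  assumes "q \<in> Q" "r \<in> Q"
  shows "\<beta> r ` fixed_points q \<subseteq> fixed_points q"
proof (clarsimp simp: fixed_points_def, intro conjI)
  fix x assume x: "x \<in> carrier G" "\<beta> q x = x"
  show "\<beta> r x \<in> carrier G" using closed[OF assms(2) x(1)] .
  show "\<beta> q (\<beta> r x) = \<beta> r x" using commute[OF assms x(1)] x(2) by simp
qed

lemma surj:
  assumes q: "q \<in> Q"
  shows "\<beta> q ` carrier G = carrier G"
proof
  show "carrier G \<subseteq> \<beta> q ` carrier G"
  proof
    fix x assume x: "x \<in> carrier G"
    \<comment> \<open>With \<open>q = n + 1\<close>, the \<open>n\<close>-fold iterate of
      \<open>x\<close> is a preimage of \<open>x\<close>.\<close>
    obtain n where n: "q = Suc n" using prime_gt_0_nat[OF prime_Q[OF q]] gr0_conv_Suc by blast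
    have "(\<beta> q ^^ n) x \<in> carrier G"
      using hom[OF q] x by (rule funpow_hom_closed)
    moreover have "x = \<beta> q ((\<beta> q ^^ n) x)"
      using period[OF q x] unfolding n by simp
    ultimately show "x \<in> \<beta> q ` carrier G" by blast
  qed
qed (use closed[OF q] in auto)

end

locale comm_prime_period_autos = comm_group + prime_period_autos
begin

text \<open>Induction on the set of primes already handled: their fixed-point subgroups join the
  subgroups to be avoided. They are invariant under the next \<open>\<beta> q\<close> because the
  automorphisms commute.\<close>

lemma ex_moved_by_all_outside:
  assumes cop: "\<And>q. q \<in> Q \<Longrightarrow> coprime q (order G)" "\<And>q. q \<in> Q \<Longrightarrow> \<exists>w\<in>carrier G. \<beta> q w \<noteq> w"
    and K: "\<And>K. K \<in> \<K> \<Longrightarrow> subgroup K G" "\<And>K q. K \<in> \<K> \<Longrightarrow> q \<in> Q \<Longrightarrow> \<beta> q ` K \<subseteq> K"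
    and v: "v \<in> carrier G" "v \<notin> \<Union>\<K>"
  shows "\<exists>x\<in>carrier G. x \<notin> \<Union>\<K> \<and> (\<forall>q\<in>Q. \<beta> q x \<noteq> x)"
proof -
  have "\<exists>x\<in>carrier G. x \<notin> \<Union>\<K> \<and> (\<forall>q\<in>R. \<beta> q x \<noteq> x)" if "R \<subseteq> Q" for R
    using finite_subset[OF that finite_Q] that
  proof (induction R)
    case empty
    then show ?case using v by blast
  next
    case (insert q R)
    then have q: "q \<in> Q" and R: "R \<subseteq> Q" by auto
    obtain x where x: "x \<in> carrier G" "x \<notin> \<Union>\<K>" "\<forall>r\<in>R. \<beta> r x \<noteq> x"
      using insert by auto
    have "\<exists>y\<in>carrier G. y \<notin> \<Union>(\<K> \<union> fixed_points ` R) \<and> \<beta> q y \<noteq> y"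
    proof (rule ex_moved_outside[OF hom[OF q] period[OF q] cop(1)[OF q] cop(2)[OF q]])
      show "x \<notin> \<Union>(\<K> \<union> fixed_points ` R)"
        using x by (auto simp: fixed_points_def)
      fix K assume "K \<in> \<K> \<union> fixed_points ` R"
      then consider "K \<in> \<K>" | r where "r \<in> Q" "K = fixed_points r" using R by blast
      then show "subgroup K G" "\<beta> q ` K \<subseteq> K"
        using K(1) K(2)[OF _ q] fixed_points_subgroup fixed_points_invariant[OF _ q] by metis+
    qed (use x in auto)
    then show ?case
      by (auto simp: fixed_points_def)
  qed
  then show ?thesis by blast
qed

end

section \<open>Quotient by the derived subgroup and groups of prime power order\<close>

context prime_period_autos
begin

lemma derived_invariant:
  assumes "q \<in> Q"
  shows "\<beta> q ` derived G (carrier G) = derived G (carrier G)"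
  using group_hom.derived_img[OF group_hom[OF assms] subset_refl] surj[OF assms] by simp

lemma image_derived_coset:
  assumes q: "q \<in> Q" and x: "x \<in> carrier G"
  shows "\<beta> q ` (derived G (carrier G) #> x) = derived G (carrier G) #> \<beta> q x"
proof -
  interpret \<beta>: group_hom G G "\<beta> q" using q by (rule group_hom)
  let ?D = "derived G (carrier G)"
  have D: "?D \<subseteq> carrier G" by (rule derived_in_carrier) simp
  have "\<beta> q ` (?D #> x) = (\<lambda>d. \<beta> q d \<otimes> \<beta> q x) ` ?D"
    using D x by (auto simp: r_coset_def image_UN subset_iff intro!: image_eqI)
  also have "\<dots> = (\<beta> q ` ?D) #> \<beta> q x"
    by (auto simp: r_coset_def)
  finally show ?thesis
    by (simp add: derived_invariant[OF q])
qed

lemma funpow_image_derived_coset: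
  assumes q: "q \<in> Q" and x: "x \<in> carrier G"
  shows "((`) (\<beta> q) ^^ n) (derived G (carrier G) #> x) = derived G (carrier G) #> (\<beta> q ^^ n) x"
  by (induction n) (simp_all add: image_derived_coset[OF q] funpow_hom_closed[OF hom[OF q] x])

text \<open>The automorphisms act on cosets by taking images. Passing to a subset \<open>R\<close>
  allows the prime of a \<open>p\<close>-group to be dropped, since the coprimality required in the
  abelian case can fail there.\<close>

lemma quotient_autos:
  assumes "R \<subseteq> Q"
  shows "comm_prime_period_autos (G Mod derived G (carrier G)) R (\<lambda>q. (`) (\<beta> q))"
proof -
  let ?D = "derived G (carrier G)"
  interpret D: normal ?D G by (rule derived_self_is_normal)
  interpret V: comm_group "G Mod ?D" by (rule derived_quot_is_comm_group)
  show ?thesis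
  proof (unfold_locales, goal_cases)
    case 1
    then show ?case using finite_subset[OF assms finite_Q] .
  next
    case (2 q)
    then show ?case using prime_Q assms by blast
  next
    case (3 q)
    then have q: "q \<in> Q" using assms by blast
    interpret \<beta>: group_hom G G "\<beta> q" using q by (rule group_hom)
    show ?case
    proof (rule homI)
      fix X Y assume "X \<in> carrier (G Mod ?D)" "Y \<in> carrier (G Mod ?D)"
      then obtain x y where "x \<in> carrier G" "X = ?D #> x" "y \<in> carrier G" "Y = ?D #> y"
        by (auto simp: carrier_FactGroup)
      then show "\<beta> q ` (X \<otimes>\<^bsub>G Mod ?D\<^esub> Y) = \<beta> q ` X \<otimes>\<^bsub>G Mod ?D\<^esub> \<beta> q ` Y"
        by (simp add: image_derived_coset[OF q] D.rcos_sum)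
    qed (auto simp: carrier_FactGroup image_derived_coset[OF q])
  next
    case (4 q X)
    then show ?case
      using assms period[of q] by (auto simp: carrier_FactGroup funpow_image_derived_coset subset_iff)
  next
    case (5 q r X)
    then have "q \<in> Q" "r \<in> Q" using assms by auto
    moreover from 5 obtain x where "x \<in> carrier G" "X = ?D #> x" by (auto simp: carrier_FactGroup)
    ultimately show ?case
      using commute by (simp add: image_derived_coset closed)
  qed
qed

text \<open>If every coset of the derived subgroup were invariant, each would contain a fixed point,
  its size being a power of \<open>p\<close> and so prime to \<open>q\<close>. The fixed points
  would then supplement the derived subgroup, hence be the whole group.\<close>

lemma quotient_moved:
  assumes nil: "nilpotent_group G" and order: "order G = p ^ a" and p: "prime p"
    and q: "q \<in> Q" "q \<noteq> p" and moves: "\<exists>x\<in>carrier G. \<beta> q x \<noteq> x"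
  shows "\<exists>X\<in>carrier (G Mod derived G (carrier G)). \<beta> q ` X \<noteq> X"
proof (rule ccontr)
  let ?D = "derived G (carrier G)"
  interpret D: normal ?D G by (rule derived_self_is_normal)
  assume *: "\<not> ?thesis"
  have fin: "finite (carrier G)"
    using order p by (metis order_gt_0_iff_finite prime_gt_0_nat zero_less_power)
  have F: "subgroup (fixed_points q) G" using q(1) by (rule fixed_points_subgroup)
  have "carrier G \<subseteq> ?D <#> fixed_points q"
  proof
    fix x assume x: "x \<in> carrier G"
    let ?X = "?D #> x"
    have X: "?X \<in> rcosets ?D" using x by (auto simp: RCOSETS_def)
    have sub: "?X \<subseteq> carrier G" using x D.subset by (rule r_coset_subset_G[rotated])
    have "\<beta> q ` ?X = ?X"
      using * X by (auto simp: FactGroup_def)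
    moreover have "\<not> q dvd card ?X"
    proof
      assume "q dvd card ?X"
      moreover have "card ?X = card ?D"
        using card_cosets_equal[OF X D.subset] bij_betw_same_card by metis
      moreover have "card ?D dvd order G"
        using lagrange[OF D.subgroup_axioms] by (metis dvd_triv_right)
      ultimately have "q dvd p ^ a" using order by (metis dvd_trans)
      then show False
        using p q prime_Q by (metis prime_dvd_power primes_dvd_imp_eq)
    qed
    ultimately have "\<exists>y\<in>?X. \<beta> q y = y"
      using fin sub period[OF q(1)]
      by (intro fixed_point_of_prime_period[OF _ _ _ prime_Q[OF q(1)]]) (auto intro: finite_subset)
    then obtain d where d: "d \<in> ?D" "\<beta> q (d \<otimes> x) = d \<otimes> x"
      by (auto simp: r_coset_def)
    have "x = inv d \<otimes> (d \<otimes> x)"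
      using d(1) x D.mem_carrier by (simp add: inv_solve_left)
    moreover have "inv d \<in> ?D" "d \<otimes> x \<in> fixed_points q"
      using d x D.mem_carrier[OF d(1)] by (auto simp: fixed_points_def)
    ultimately show "x \<in> ?D <#> fixed_points q"
      unfolding set_mult_def by blast
  qed
  then have "carrier G \<subseteq> fixed_points q <#> ?D"
    using commut_normal[OF F derived_self_is_normal] by simp
  moreover have "fixed_points q <#> ?D \<subseteq> carrier G"
    using subgroup.subset[OF F] D.subset by (rule setmult_subset_G)
  ultimately have "fixed_points q <#> ?D = carrier G" by blast
  moreover have "fixed_points q \<noteq> carrier G"
    using moves by (auto simp: fixed_points_def)
  ultimately show False
    using nilpotent_proper_subgroup_derived[OF nil fin F] by blast
qed

text \<open>Avoiding \<open>Fix(\<beta>\<^sub>p) D / D\<close> in \<open>V = G/D\<close>, with \<open>D\<close> the derived subgroup, handles the prime \<open>p\<close>, where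
  \<open>\<beta>\<^sub>p\<close> may well act trivially on \<open>V\<close>.\<close>

lemma nilpotent_p_group_ex_moved_by_all:
  assumes nil: "nilpotent_group G" and order: "order G = p ^ a" and p: "prime p"
    and moves: "\<And>q. q \<in> Q \<Longrightarrow> \<exists>x\<in>carrier G. \<beta> q x \<noteq> x"
  shows "\<exists>x\<in>carrier G. \<forall>q\<in>Q. \<beta> q x \<noteq> x"
proof -
  let ?D = "derived G (carrier G)"
  let ?V = "G Mod ?D"
  interpret D: normal ?D G by (rule derived_self_is_normal)
  interpret V: comm_prime_period_autos ?V "Q - {p}" "\<lambda>q. (`) (\<beta> q)"
    by (rule quotient_autos) auto
  have fin: "finite (carrier G)"
    using order p by (metis order_gt_0_iff_finite prime_gt_0_nat zero_less_power)
  have \<pi>: "group_hom G ?V (\<lambda>x. ?D #> x)"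
    using D.r_coset_hom_Mod V.is_group by unfold_locales
  \<comment> \<open>Empty if \<open>p\<close> is not in \<open>Q\<close>; the identity of
    \<open>?V\<close> then serves as starting point.\<close>
  define \<K> where "\<K> = (if p \<in> Q then {(\<lambda>x. ?D #> x) ` fixed_points p} else {})"
  have "\<exists>v\<in>carrier ?V. v \<notin> \<Union>\<K>"
  proof (cases "p \<in> Q")
    case True
    have F: "subgroup (fixed_points p) G" using True by (rule fixed_points_subgroup)
    have "fixed_points p \<noteq> carrier G"
      using moves[OF True] by (auto simp: fixed_points_def)
    then have "?D <#> fixed_points p \<noteq> carrier G"
      using nilpotent_proper_subgroup_derived[OF nil fin F] commut_normal[OF F derived_self_is_normal] by simp
    moreover have "?D <#> fixed_points p \<subseteq> carrier G"
      using D.subset subgroup.subset[OF F] by (rule setmult_subset_G)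
    ultimately obtain x where x: "x \<in> carrier G" "x \<notin> ?D <#> fixed_points p" by blast
    have "?D #> x \<noteq> ?D #> y" if "y \<in> fixed_points p" for y
    proof
      assume "?D #> x = ?D #> y"
      then have "x \<in> ?D #> y" using rcos_self[OF x(1) D.subgroup_axioms] by simp
      then show False using x(2) that by (auto simp: r_coset_def set_mult_def)
    qed
    then have "?D #> x \<notin> \<Union>\<K>" by (auto simp: \<K>_def)
    then show ?thesis using x(1) by (auto simp: carrier_FactGroup)
  next
    case False
    then show ?thesis by (auto simp: \<K>_def intro!: exI[of _ "\<one>\<^bsub>?V\<^esub>"])
  qed
  then obtain v where v: "v \<in> carrier ?V" "v \<notin> \<Union>\<K>" by blast
  have "\<exists>X\<in>carrier ?V. X \<notin> \<Union>\<K> \<and> (\<forall>q\<in>Q - {p}. \<beta> q ` X \<noteq> X)"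
  proof (rule V.ex_moved_by_all_outside[OF _ _ _ _ v])
    fix q assume q: "q \<in> Q - {p}"
    have "order ?V dvd order G"
      using lagrange[OF D.subgroup_axioms] by (simp add: order_def FactGroup_def) (metis dvd_triv_left)
    moreover have "coprime q (p ^ a)"
      using q p prime_Q by (simp add: primes_coprime)
    ultimately show "coprime q (order ?V)"
      using order by (metis coprime_divisors dvd_refl)
    show "\<exists>X\<in>carrier ?V. \<beta> q ` X \<noteq> X"
      using q quotient_moved[OF nil order p _ _ moves] by simp
  next
    fix K assume K: "K \<in> \<K>"
    then have pQ: "p \<in> Q" and K_eq: "K = (\<lambda>x. ?D #> x) ` fixed_points p"
      by (auto simp: \<K>_def split: if_splits)
    show "subgroup K ?V"
      unfolding K_eq by (rule group_hom.subgroup_img_is_subgroup[OF \<pi> fixed_points_subgroup[OF pQ]])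
    fix q assume q: "q \<in> Q - {p}"
    show "(`) (\<beta> q) ` K \<subseteq> K"
    proof clarify
      fix X assume "X \<in> K"
      then obtain x where x: "x \<in> fixed_points p" "X = ?D #> x" by (auto simp: K_eq)
      then have "\<beta> q ` X = ?D #> \<beta> q x"
        using q by (simp add: image_derived_coset fixed_points_def)
      moreover have "\<beta> q x \<in> fixed_points p"
        using fixed_points_invariant[OF pQ, of q] q x(1) by auto
      ultimately show "\<beta> q ` X \<in> K" by (simp add: K_eq)
    qed
  qed
  then obtain x where x: "x \<in> carrier G" "?D #> x \<notin> \<Union>\<K>"
    "\<And>q. q \<in> Q - {p} \<Longrightarrow> \<beta> q ` (?D #> x) \<noteq> ?D #> x"
    by (auto simp: carrier_FactGroup)
  \<comment> \<open>If \<open>x\<close> were fixed, its coset would lie in the avoided subgroup when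
    \<open>q = p\<close>, and would be invariant under \<open>\<beta> q\<close> otherwise.\<close>
  have "\<beta> q x \<noteq> x" if q: "q \<in> Q" for q
  proof (cases "q = p")
    case True
    then show ?thesis using x(1,2) q by (auto simp: \<K>_def fixed_points_def)
  next
    case False
    then show ?thesis using x(3)[of q] q image_derived_coset[OF q x(1)] by auto
  qed
  then show ?thesis using x(1) by blast
qed

section \<open>Combining the Sylow subgroups\<close>

lemma subgroup_autos:
  assumes H: "subgroup H G" and R: "R \<subseteq> Q" and inv: "\<And>q. q \<in> R \<Longrightarrow> \<beta> q ` H \<subseteq> H"
  shows "prime_period_autos (G\<lparr>carrier := H\<rparr>) R \<beta>"
proof -
  interpret H: group "G\<lparr>carrier := H\<rparr>" using H by (rule subgroup_imp_group)
  note HG = subgroup.mem_carrier[OF H]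
  show ?thesis
  proof (unfold_locales, goal_cases)
    case 1
    then show ?case using finite_subset[OF R finite_Q] .
  next
    case (2 q)
    then show ?case using R prime_Q by blast
  next
    case (3 q)
    then show ?case
      using inv[of q] hom[of q] R HG by (auto simp: hom_def Pi_iff)
  next
    case (4 q x)
    then show ?case using R HG period by auto
  next
    case (5 q r x)
    then show ?case using R HG[of x] commute[of q r x] by auto
  qed
qed

text \<open>The case of prime power order, applied to the Sylow subgroup and to those
  \<open>\<beta> q\<close> that act nontrivially on it.\<close>

lemma prime_part_ex_moved:
  assumes nil: "nilpotent_group G" and fin: "finite (carrier G)" and p: "prime p"
  shows "\<exists>y\<in>prime_part p. \<forall>q\<in>Q. (\<exists>z\<in>prime_part p. \<beta> q z \<noteq> z) \<longrightarrow> \<beta> q y \<noteq> y"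
proof -
  let ?P = "prime_part p"
  have P: "subgroup ?P G"
    using nilpotent_prime_part(1)[OF nil fin p] by (rule normal_imp_subgroup)
  interpret P: prime_period_autos "G\<lparr>carrier := ?P\<rparr>" "{q \<in> Q. \<exists>z\<in>?P. \<beta> q z \<noteq> z}" \<beta>
    using hom_image_prime_part[OF hom] by (intro subgroup_autos[OF P]) auto
  have "\<exists>y\<in>carrier (G\<lparr>carrier := ?P\<rparr>). \<forall>q\<in>{q \<in> Q. \<exists>z\<in>?P. \<beta> q z \<noteq> z}. \<beta> q y \<noteq> y"
    using nilpotent_prime_part(2)[OF nil fin p]
    by (intro P.nilpotent_p_group_ex_moved_by_all[OF nilpotent_subgroup[OF nil P] _ p]) (auto simp: order_def)
  then show ?thesis by auto
qed

text \<open>Otherwise the fixed points of \<open>\<beta> q\<close> contain the Sylow subgroup for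
  every prime, so their number is divisible by \<open>order G\<close>.\<close>

lemma ex_prime_part_moved:
  assumes nil: "nilpotent_group G" and fin: "finite (carrier G)"
    and q: "q \<in> Q" and moves: "\<exists>x\<in>carrier G. \<beta> q x \<noteq> x"
  shows "\<exists>p. prime p \<and> (\<exists>z\<in>prime_part p. \<beta> q z \<noteq> z)"
proof (rule ccontr)
  assume *: "\<not> ?thesis"
  let ?F = "fixed_points q"
  have F: "subgroup ?F G" using q by (rule fixed_points_subgroup)
  interpret F: group "G\<lparr>carrier := ?F\<rparr>" using F by (rule subgroup_imp_group)
  have finF: "finite ?F" using subgroup.subset[OF F] fin by (rule finite_subset)
  then have pos: "card ?F \<noteq> 0" using subgroup.one_closed[OF F] by auto
  have order_F: "order (G\<lparr>carrier := ?F\<rparr>) = card ?F" by (simp add: order_def)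
  have "order G dvd card ?F"
  proof (rule multiplicity_le_imp_dvd)
    show "order G \<noteq> 0" using fin order_gt_0_iff_finite by simp
    fix p :: nat assume p: "prime p"
    have P: "subgroup (prime_part p) G"
      using nilpotent_prime_part(1)[OF nil fin p] by (rule normal_imp_subgroup)
    have "prime_part p \<subseteq> ?F"
      using * p by (auto simp: fixed_points_def prime_part_def)
    then have "subgroup (prime_part p) (G\<lparr>carrier := ?F\<rparr>)"
      by (rule subgroup_incl[OF P F])
    from F.lagrange[OF this] have "card (prime_part p) dvd card ?F"
      using dvd_triv_right[of "card (prime_part p)"] by (metis order_F)
    then show "multiplicity p (order G) \<le> multiplicity p (card ?F)"
      using nilpotent_prime_part(2)[OF nil fin p] p pos not_prime_unit by (intro multiplicity_geI) auto
  qed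
  then have "card (carrier G) \<le> card ?F"
    using pos by (simp add: order_def dvd_imp_le)
  then have "?F = carrier G"
    using fin subgroup.subset[OF F] by (simp add: card_seteq)
  then show False using moves by (auto simp: fixed_points_def)
qed

text \<open>The conditions at primes outside \<open>T\<close> carry the induction: the next factor
  \<open>y\<close>, taken from \<open>prime_part p\<close>, commutes with \<open>x\<close> and is
  killed by a power of \<open>p\<close> coprime to \<open>ord x\<close>.\<close>

lemma combine_prime_parts:
  assumes nil: "nilpotent_group G" and fin: "finite (carrier G)"
    and T: "finite T" "\<And>p. p \<in> T \<Longrightarrow> prime p"
  shows "\<exists>x\<in>carrier G. (\<forall>p. prime p \<longrightarrow> p \<notin> T \<longrightarrow> coprime p (ord x) \<and> (\<forall>z\<in>prime_part p. x \<otimes> z = z \<otimes> x)) \<and>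
    (\<forall>p\<in>T. \<forall>q\<in>Q. (\<exists>z\<in>prime_part p. \<beta> q z \<noteq> z) \<longrightarrow> \<beta> q x \<noteq> x)"
  using T
proof (induction T)
  case empty
  then show ?case by (intro bexI[of _ \<one>]) (auto simp: prime_part_def)
next
  case (insert p T)
  then have p: "prime p" by simp
  let ?pa = "p ^ multiplicity p (order G)"
  obtain x where x: "x \<in> carrier G"
    and cop: "\<And>r. prime r \<Longrightarrow> r \<notin> T \<Longrightarrow> coprime r (ord x)"
    and comm: "\<And>r z. prime r \<Longrightarrow> r \<notin> T \<Longrightarrow> z \<in> prime_part r \<Longrightarrow> x \<otimes> z = z \<otimes> x"
    and moved: "\<And>r q. r \<in> T \<Longrightarrow> q \<in> Q \<Longrightarrow> \<exists>z\<in>prime_part r. \<beta> q z \<noteq> z \<Longrightarrow> \<beta> q x \<noteq> x"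
    using insert.IH insert.prems by fastforce
  obtain y where yP: "y \<in> prime_part p"
    and ymoved: "\<And>q. q \<in> Q \<Longrightarrow> \<exists>z\<in>prime_part p. \<beta> q z \<noteq> z \<Longrightarrow> \<beta> q y \<noteq> y"
    using prime_part_ex_moved[OF nil fin p] by blast
  have y: "y \<in> carrier G" "y [^] ?pa = \<one>" using yP by (auto simp: prime_part_def)
  have xy: "x \<otimes> y = y \<otimes> x" using comm[OF p insert.hyps(2) yP] .
  have pow: "(x \<otimes> y) [^] n = x [^] n \<otimes> y [^] n" for n :: nat
    using pow_mult_distrib[OF xy x y(1)] .
  have cop_pa: "coprime ?pa (ord x)" using cop[OF p insert.hyps(2)] by simp
  have "coprime r (ord (x \<otimes> y)) \<and> (\<forall>z\<in>prime_part r. x \<otimes> y \<otimes> z = z \<otimes> (x \<otimes> y))"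
    if r: "prime r" "r \<notin> insert p T" for r
  proof
    have "x [^] (ord x * ?pa) = \<one>" using x by (simp add: pow_eq_id)
    moreover have "y [^] (ord x * ?pa) = \<one>" using y by (simp add: pow_eq_id)
    ultimately have "(x \<otimes> y) [^] (ord x * ?pa) = \<one>" using x y(1) by (simp add: pow)
    then have "ord (x \<otimes> y) dvd ord x * ?pa" using x y(1) by (simp add: pow_eq_id)
    moreover have "coprime r (ord x * ?pa)"
      using cop[OF r(1)] r p by (simp add: primes_coprime)
    ultimately show "coprime r (ord (x \<otimes> y))"
      by (metis coprime_divisors dvd_refl)
    show "\<forall>z\<in>prime_part r. x \<otimes> y \<otimes> z = z \<otimes> (x \<otimes> y)"
    proof
      fix z assume z: "z \<in> prime_part r"
      then have "z \<in> carrier G" by (simp add: prime_part_def)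
      moreover have "y \<otimes> z = z \<otimes> y"
        using r(2) by (intro prime_part_commute[OF nil fin p r(1) _ yP z]) auto
      moreover have "x \<otimes> z = z \<otimes> x" using comm[OF r(1) _ z] r(2) by simp
      ultimately show "x \<otimes> y \<otimes> z = z \<otimes> (x \<otimes> y)"
        using x y(1) by (intro mult_commute)
    qed
  qed
  moreover have "\<beta> q (x \<otimes> y) \<noteq> x \<otimes> y"
    if r: "r \<in> insert p T" and q: "q \<in> Q" and z: "\<exists>z\<in>prime_part r. \<beta> q z \<noteq> z" for r q
  proof
    let ?F = "fixed_points q"
    assume "\<beta> q (x \<otimes> y) = x \<otimes> y"
    then have xyF: "x \<otimes> y \<in> ?F" using x y(1) by (simp add: fixed_points_def)
    have F: "subgroup ?F G" using q by (rule fixed_points_subgroup)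
    have powF: "(x \<otimes> y) [^] n \<in> ?F" for n :: nat
      using subgroup.one_closed[OF F] subgroup.m_closed[OF F _ xyF] by (induction n) auto
    \<comment> \<open>Raising \<open>x \<otimes> y\<close> to the power \<open>?pa\<close> kills
      \<open>y\<close>, and raising it to \<open>ord x\<close> kills \<open>x\<close>. Coprimality
      then recovers both factors as fixed points.\<close>
    have "x [^] ?pa \<in> ?F" using powF[of ?pa] x y by (simp add: pow)
    then have "x \<in> ?F"
      using mem_of_coprime_pow_mem[OF F x, of "ord x" ?pa] x cop_pa by simp
    moreover have "y [^] ord x \<in> ?F" using powF[of "ord x"] x y by (simp add: pow)
    then have "y \<in> ?F"
      using mem_of_coprime_pow_mem[OF F y, of "ord x"] cop_pa by (simp add: coprime_commute)
    ultimately show False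
      using r moved[OF _ q] ymoved[OF q] z by (auto simp: fixed_points_def)
  qed
  ultimately show ?case
    using x y(1) by (intro bexI[of _ "x \<otimes> y"]) auto
qed

text \<open>Each \<open>q\<close> is assigned a prime \<open>p q\<close> on whose Sylow subgroup
  \<open>\<beta> q\<close> acts nontrivially; the finitely many primes chosen form the set
  \<open>T\<close> of the preceding lemma.\<close>

lemma nilpotent_ex_moved_by_all:
  assumes nil: "nilpotent_group G" and fin: "finite (carrier G)"
    and moves: "\<And>q. q \<in> Q \<Longrightarrow> \<exists>x\<in>carrier G. \<beta> q x \<noteq> x"
  shows "\<exists>x\<in>carrier G. \<forall>q\<in>Q. \<beta> q x \<noteq> x"
proof -
  have "\<forall>q\<in>Q. \<exists>p. prime p \<and> (\<exists>z\<in>prime_part p. \<beta> q z \<noteq> z)"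
    using ex_prime_part_moved[OF nil fin _ moves] by auto
  then obtain p where p: "\<And>q. q \<in> Q \<Longrightarrow> prime (p q) \<and> (\<exists>z\<in>prime_part (p q). \<beta> q z \<noteq> z)"
    by metis
  have "\<And>r. r \<in> p ` Q \<Longrightarrow> prime r" using p by auto
  from combine_prime_parts[OF nil fin finite_imageI[OF finite_Q] this]
  obtain x where "x \<in> carrier G"
    and x: "\<forall>r\<in>p ` Q. \<forall>q\<in>Q. (\<exists>z\<in>prime_part r. \<beta> q z \<noteq> z) \<longrightarrow> \<beta> q x \<noteq> x"
    by blast
  moreover have "\<forall>q\<in>Q. \<beta> q x \<noteq> x"
    using x p by (meson imageI)
  ultimately show ?thesis by blast
qed

end

subsection \<open>Regular cycles of automorphisms\<close>

lemma carrier_BijGroup: "carrier (BijGroup S) = Bij S"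
  by (simp add: BijGroup_def)

lemma BijGroup_pow_closed:
  assumes "f \<in> Bij S"
  shows "f [^]\<^bsub>BijGroup S\<^esub> (n::nat) \<in> Bij S"
proof -
  interpret B: group "BijGroup S" by (rule group_BijGroup)
  show ?thesis
    using B.nat_pow_closed[of f n] assms unfolding carrier_BijGroup .
qed

text \<open>Multiplication in \<open>BijGroup S\<close> is composition restricted to
  \<open>S\<close>, while \<open>f ^^ n\<close> iterates the unrestricted function; the two are
  compared at points of \<open>S\<close>.\<close>

lemma BijGroup_pow_apply:
  assumes "f \<in> Bij S" "x \<in> S"
  shows "(f [^]\<^bsub>BijGroup S\<^esub> (n::nat)) x = (f ^^ n) x"
proof -
  interpret B: group "BijGroup S" by (rule group_BijGroup)
  show ?thesis
    using assms(2)
  proof (induction n arbitrary: x)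
    case 0
    then show ?case by (simp add: BijGroup_def)
  next
    case (Suc n)
    have pow: "f [^]\<^bsub>BijGroup S\<^esub> n \<in> Bij S"
      using assms(1) by (rule BijGroup_pow_closed)
    have "f x \<in> S"
      using Bij_imp_funcset[OF assms(1)] Suc.prems by (rule funcset_mem)
    then have "(f [^]\<^bsub>BijGroup S\<^esub> n) (f x) = (f ^^ n) (f x)" by (rule Suc.IH)
    moreover have "g \<otimes>\<^bsub>BijGroup S\<^esub> f = compose S g f" if "g \<in> Bij S" for g
      using that assms(1) by (simp add: BijGroup_def)
    ultimately show ?case
      using pow Suc.prems by (simp add: compose_def funpow_swap1)
  qed
qed

lemma BijGroup_pow_eq_one_iff:
  assumes "f \<in> Bij S"
  shows "f [^]\<^bsub>BijGroup S\<^esub> (n::nat) = \<one>\<^bsub>BijGroup S\<^esub> \<longleftrightarrow> (\<forall>x\<in>S. (f ^^ n) x = x)"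
proof -
  have ext: "f [^]\<^bsub>BijGroup S\<^esub> n \<in> extensional S"
    using BijGroup_pow_closed[OF assms] by (rule Bij_imp_extensional)
  have one: "\<one>\<^bsub>BijGroup S\<^esub> = (\<lambda>x\<in>S. x)" by (simp add: BijGroup_def)
  have "f [^]\<^bsub>BijGroup S\<^esub> n = \<one>\<^bsub>BijGroup S\<^esub> \<longleftrightarrow> (\<forall>x\<in>S. (f [^]\<^bsub>BijGroup S\<^esub> n) x = x)"
  proof
    assume "\<forall>x\<in>S. (f [^]\<^bsub>BijGroup S\<^esub> n) x = x"
    then show "f [^]\<^bsub>BijGroup S\<^esub> n = \<one>\<^bsub>BijGroup S\<^esub>"
      unfolding one using ext by (intro extensionalityI[of _ S]) auto
  qed (simp add: one)
  then show ?thesis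
    by (simp add: BijGroup_pow_apply[OF assms])
qed

lemma finite_carrier_BijGroup:
  assumes "finite S"
  shows "finite (carrier (BijGroup S))"
proof (rule finite_subset)
  show "carrier (BijGroup S) \<subseteq> S \<rightarrow>\<^sub>E S"
    using Bij_imp_extensional Bij_imp_funcset unfolding carrier_BijGroup PiE_def by blast
qed (use assms in \<open>simp add: finite_PiE\<close>)

section \<open>From a moved point to a regular cycle\<close>

text \<open>The orbit length of \<open>x\<close> divides the order of \<open>\<alpha>\<close>. A
  prime \<open>q\<close> dividing the cofactor \<open>k\<close> would make it divide
  \<open>?n div q\<close> as well, so that this power of \<open>\<alpha>\<close> would fix
  \<open>x\<close>.\<close>

lemma RCC_if_moved:
  assumes \<alpha>: "\<alpha> \<in> Bij S" and fin: "finite S" and x: "x \<in> S"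
    and moved: "\<And>q. q \<in> prime_factors (group.ord (BijGroup S) \<alpha>) \<Longrightarrow>
      (\<alpha> ^^ (group.ord (BijGroup S) \<alpha> div q)) x \<noteq> x"
  shows "RCC S \<alpha>"
proof -
  interpret B: group "BijGroup S" by (rule group_BijGroup)
  let ?n = "B.ord \<alpha>"
  have \<alpha>B: "\<alpha> \<in> carrier (BijGroup S)" using \<alpha> by (simp add: carrier_BijGroup)
  \<comment> \<open>An element of infinite order has \<open>ord\<close> 0; finiteness of
    \<open>S\<close> excludes this.\<close>
  have n: "?n > 0"
    using B.ord_ge_1[OF finite_carrier_BijGroup[OF fin] \<alpha>B] by simp
  have period: "(\<alpha> ^^ ?n) x = x"
    using BijGroup_pow_eq_one_iff[OF \<alpha>, of ?n] B.pow_ord_eq_1[OF \<alpha>B] x by blast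
  then have self: "x \<in> orbit \<alpha> x" using n by (rule self_in_orbitI)
  obtain k where k: "?n = card (orbit \<alpha> x) * k"
    using card_orbit_dvd_iff[OF self] period by blast
  have "k = 1"
  proof (rule ccontr)
    assume "k \<noteq> 1"
    then obtain q where q: "prime q" "q dvd k" by (metis prime_factor_nat)
    then obtain l where l: "k = q * l" by blast
    have "?n div q = card (orbit \<alpha> x) * l"
      using q(1) by (simp add: k l prime_gt_0_nat)
    then have "(\<alpha> ^^ (?n div q)) x = x"
      using card_orbit_dvd_iff[OF self, of "?n div q"] by simp
    moreover have "q \<in> prime_factors ?n"
      using q n k by (auto simp: prime_factors_dvd)
    ultimately show False using moved by blast
  qed
  then have card: "card (orbit \<alpha> x) = ?n" using k by simp
  have "orbit \<alpha> x \<subseteq> S"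
  proof
    fix y assume "y \<in> orbit \<alpha> x"
    then show "y \<in> S" using x Bij_imp_funcset[OF \<alpha>] by induction auto
  qed
  then show ?thesis
    using card self by (auto simp: RCC_def regular_cycle_def cyclic_on_def)
qed

theorem corollary2p10:
  fixes G :: "('a, 'b) monoid_scheme"
  assumes "nilpotent_group G" and "finite (carrier G)"
  shows "RCC_group G"
proof -
  interpret G: group G using assms(1) by (simp add: nilpotent_group_def)
  interpret B: group "BijGroup (carrier G)" by (rule group_BijGroup)
  have "RCC (carrier G) \<alpha>" if "\<alpha> \<in> auto G" for \<alpha>
  proof -
    have \<alpha>: "\<alpha> \<in> hom G G" "\<alpha> \<in> Bij (carrier G)" using that by (auto simp: auto_def)
    let ?n = "B.ord \<alpha>"
    define \<beta> where "\<beta> q = \<alpha> ^^ (?n div q)" for q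
    have \<alpha>B: "\<alpha> \<in> carrier (BijGroup (carrier G))" using \<alpha>(2) by (simp add: carrier_BijGroup)
    have n: "?n > 0"
      using B.ord_ge_1[OF finite_carrier_BijGroup[OF assms(2)] \<alpha>B] by simp
    have pow_hom: "\<alpha> ^^ k \<in> hom G G" for k
    proof (rule homI)
      show "(\<alpha> ^^ k) x \<in> carrier G" if "x \<in> carrier G" for x
        using \<alpha>(1) that by (rule funpow_hom_closed)
      show "(\<alpha> ^^ k) (x \<otimes>\<^bsub>G\<^esub> y) = (\<alpha> ^^ k) x \<otimes>\<^bsub>G\<^esub> (\<alpha> ^^ k) y"
        if "x \<in> carrier G" "y \<in> carrier G" for x y
        by (induction k) (simp_all add: hom_mult[OF \<alpha>(1)] funpow_hom_closed[OF \<alpha>(1)] that)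
    qed
    interpret \<beta>: prime_period_autos G "prime_factors ?n" \<beta>
    proof (unfold_locales, goal_cases)
      case (4 q x)
      then have "?n div q * q = ?n" by (auto simp: prime_factors_dvd)
      then have "(\<beta> q ^^ q) x = (\<alpha> ^^ ?n) x" by (simp add: \<beta>_def funpow_mult)
      also have "\<dots> = x"
        using BijGroup_pow_eq_one_iff[OF \<alpha>(2), of ?n] B.pow_ord_eq_1[OF \<alpha>B] 4 by blast
      finally show ?case .
    next
      case (5 q r x)
      have "\<beta> q (\<beta> r x) = (\<alpha> ^^ (?n div q + ?n div r)) x"
        by (simp add: \<beta>_def funpow_add)
      also have "\<dots> = \<beta> r (\<beta> q x)"
        unfolding add.commute[of "?n div q"] by (simp add: \<beta>_def funpow_add)
      finally show ?case .
    qed (auto simp: \<beta>_def pow_hom)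
    have "\<exists>x\<in>carrier G. \<forall>q\<in>prime_factors ?n. \<beta> q x \<noteq> x"
    proof (rule \<beta>.nilpotent_ex_moved_by_all[OF assms])
      fix q assume q: "q \<in> prime_factors ?n"
      then have "1 < q" "q dvd ?n"
        using prime_gt_1_nat[OF in_prime_factors_imp_prime] in_prime_factors_imp_dvd by blast+
      then have "0 < ?n div q" "?n div q < ?n"
        using n by (auto simp: div_greater_zero_iff dest: dvd_imp_le)
      \<comment> \<open>Being positive and smaller than the order of \<open>\<alpha>\<close>, the
        exponent \<open>?n div q\<close> does not give the identity, so \<open>\<beta> q\<close>
        moves some point.\<close>
      then have "\<not> ?n dvd ?n div q"
        by (simp add: nat_dvd_not_less)
      then show "\<exists>x\<in>carrier G. \<beta> q x \<noteq> x"
        using BijGroup_pow_eq_one_iff[OF \<alpha>(2), of "?n div q"] B.pow_eq_id[OF \<alpha>B, of "?n div q"]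
        by (auto simp: \<beta>_def)
    qed
    then show ?thesis
      using RCC_if_moved[OF \<alpha>(2) assms(2)] by (auto simp: \<beta>_def)
  qed
  then show ?thesis
    using assms(2) G.is_group by (simp add: RCC_group_def)
qed

end
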